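(* Let $n>2$ be an integer and $\omega=\exp(2\pi\mathrm{i}/n)$. Define polynomials $P_k^{(j)}$ ($1\le j\le n$, $k\in\mathbb{N}_0$) by $P_0^{(j)}(x)=x$ for all $1\le j\le n$ and $$P_{k+1}^{(j)}(x)=\sum_{r=1}^{n}\omega^{(j-1)(r-1)}\,x^{(r-1)n^k}\,P_k^{(r)}(x),\qquad 1\le j\le n,\ k\in\mathbb{N}_0.$$ Let $(\varepsilon_m)_{m\in\mathbb{N}}$ be the sequence with values in $\{\omega^j\mid 0\le j\le n-1\}$ determined by $P_k^{(1)}(x)=\sum_{m=1}^{n^k}\varepsilon_m x^m$ for all $k\in\mathbb{N}_0$. Then $(\varepsilon_m)_{m\in\mathbb{N}}$ has the root-$N$ property: there is a constant $C>0$ such that for all integers $N\ge1$, $$\sup_{x\in\mathbb{C},\,|x|=1}\left|\sum_{m=1}^{N}\varepsilon_m x^m\right|\le C\,N^{1/2}.$$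
   Context: $\mathbb{N}=\{1,2,3,\dots\}$ and $\mathbb{N}_0=\mathbb{N}\cup\{0\}$. The recurrence is $v_{k+1}=A^{(n,k)}v_k$ for the vector $v_k=(P_k^{(1)}(x),\dots,P_k^{(n)}(x))^t$, where $A^{(n,k)}$ is the $n\times n$ matrix with entries $\omega^{(j-1)(r-1)}x^{(r-1)n^k}$ in row $j$ and column $r$. The sequence $(\varepsilon_m)$ is well defined because the terms of $P_{k+1}^{(1)}$ of degree at most $n^k$ coincide with those of $P_k^{(1)}$. *)

theory Defs
  imports "HOL-Analysis.Analysis" "HOL-Computational_Algebra.Polynomial"
begin

definition root_unity :: "nat \<Rightarrow> complex" where
  "root_unity n = exp (2 * of_real pi * \<i> / of_nat n)"

text \<open>The polynomial written $P_k^{(j)}$ is \<open>P_poly n k j\<close>; only the indices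
  \<open>1 \<le> j \<le> n\<close> are meaningful, so the truncated subtractions are genuine ones.\<close>

primrec P_poly :: "nat \<Rightarrow> nat \<Rightarrow> nat \<Rightarrow> complex poly" where
  "P_poly n 0 = (\<lambda>j. monom 1 1)"
| "P_poly n (Suc k) = (\<lambda>j. \<Sum>r = 1..n.
     monom (root_unity n ^ ((j - 1) * (r - 1))) ((r - 1) * n ^ k) * P_poly n k r)"

text \<open>Sequences are indexed by the positive integers; the value at \<open>0\<close> is irrelevant.\<close>

definition is_eps_seq :: "nat \<Rightarrow> (nat \<Rightarrow> complex) \<Rightarrow> bool" where
  "is_eps_seq n \<epsilon> \<longleftrightarrow>
     (\<forall>m\<ge>1. \<epsilon> m \<in> {root_unity n ^ j | j. j \<le> n - 1}) \<and>
     (\<forall>k. P_poly n k 1 = (\<Sum>m = 1..n ^ k. monom (\<epsilon> m) m))"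

text \<open>The supremum is over a nonempty set that is bounded above by the sum of the
  \<open>norm (\<epsilon> m)\<close>, so the real-valued \<open>SUP\<close> is the true one.\<close>

definition root_N_property :: "(nat \<Rightarrow> complex) \<Rightarrow> bool" where
  "root_N_property \<epsilon> \<longleftrightarrow>
     (\<exists>C::real. C > 0 \<and> (\<forall>N::nat. N \<ge> 1 \<longrightarrow>
        (SUP x\<in>{x::complex. norm x = 1}. norm (\<Sum>m = 1..N. \<epsilon> m * x ^ m)) \<le> C * sqrt (real N)))"

lemma root_unity_power_n:
  assumes "n > 0" shows "root_unity n ^ n = 1"
proof -
  have "root_unity n ^ n = exp (of_nat n * (2 * of_real pi * \<i> / of_nat n))"
    unfolding root_unity_def by (rule exp_of_nat_mult[symmetric])
  also have "of_nat n * (2 * of_real pi * \<i> / of_nat n) = 2 * of_real pi * \<i>"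
    using assms by simp
  finally show ?thesis by simp
qed

lemma root_unity_power_mod:
  assumes "n > 0" shows "root_unity n ^ a \<in> {root_unity n ^ j | j. j \<le> n - 1}"
proof -
  have "root_unity n ^ a = root_unity n ^ (n * (a div n) + a mod n)" by simp
  also have "\<dots> = root_unity n ^ (a mod n)"
    unfolding power_add power_mult root_unity_power_n[OF assms] by simp
  finally show ?thesis using mod_less_divisor[OF assms, of a] by fastforce
qed

lemma coeff_P_poly_Suc:
  "coeff (P_poly n (Suc k) j) m = (\<Sum>r = 1..n. if (r - 1) * n ^ k \<le> m
     then root_unity n ^ ((j - 1) * (r - 1)) * coeff (P_poly n k r) (m - (r - 1) * n ^ k) else 0)"
  by (simp add: coeff_sum coeff_monom_mult)
     (intro sum.cong refl, auto)

lemma coeff_P_poly: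
  assumes n: "n > 0"
  shows "(m \<in> {1..n ^ k} \<longrightarrow> (\<exists>a. coeff (P_poly n k j) m = root_unity n ^ a)) \<and>
         (m \<notin> {1..n ^ k} \<longrightarrow> coeff (P_poly n k j) m = 0)"
proof (induction k arbitrary: j m)
  case 0
  show ?case by (auto intro: exI[of _ 0])
next
  case (Suc k)
  let ?q = "n ^ k"
  have q: "?q > 0" using n by simp
  let ?t = "\<lambda>r. if (r - 1) * ?q \<le> m
     then root_unity n ^ ((j - 1) * (r - 1)) * coeff (P_poly n k r) (m - (r - 1) * ?q) else 0"
  have z: "?t r = 0" if "\<not> ((r - 1) * ?q < m \<and> m \<le> (r - 1) * ?q + ?q)" for r
    using that Suc.IH[of "m - (r - 1) * ?q" r] by auto
  show ?case
  proof (intro conjI impI)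
    assume m: "m \<in> {1..n ^ Suc k}"
    define s where "s = (m - 1) div ?q"
    have s1: "s * ?q \<le> m - 1" unfolding s_def by simp
    have s2: "m - 1 < s * ?q + ?q" unfolding s_def
      using dividend_less_div_times[OF q, of "m - 1"] by simp
    have "s < n" unfolding s_def using m q n
      by (simp add: div_less_iff_less_mult) (metis One_nat_def Suc_le_lessD Suc_pred less_le_trans not_less_eq_eq)
    have s3: "s * ?q < m" "m \<le> s * ?q + ?q" using s1 s2 m by auto
    have oth: "?t r = 0" if "r \<in> {1..n} - {Suc s}" for r
    proof (rule z, rule notI)
      assume a: "(r - 1) * ?q < m \<and> m \<le> (r - 1) * ?q + ?q"
      have "(r - 1) * ?q < (s + 1) * ?q" "s * ?q < (r - 1 + 1) * ?q" using a s3 by auto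
      then have "r - 1 < s + 1" "s < r - 1 + 1" using mult_less_cancel2 by blast+
      then show False using that by auto
    qed
    have "coeff (P_poly n (Suc k) j) m = (\<Sum>r\<in>{Suc s}. ?t r)"
      unfolding coeff_P_poly_Suc
      by (rule sum.mono_neutral_right) (use \<open>s < n\<close> oth in auto)
    also have "\<dots> = root_unity n ^ ((j - 1) * s) * coeff (P_poly n k (Suc s)) (m - s * ?q)"
      using s3 by simp
    finally have e: "coeff (P_poly n (Suc k) j) m =
      root_unity n ^ ((j - 1) * s) * coeff (P_poly n k (Suc s)) (m - s * ?q)" .
    have "m - s * ?q \<in> {1..?q}" using s3 by auto
    then obtain a where "coeff (P_poly n k (Suc s)) (m - s * ?q) = root_unity n ^ a"
      using Suc.IH by blast
    then show "\<exists>a. coeff (P_poly n (Suc k) j) m = root_unity n ^ a"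
      using e by (metis power_add)
  next
    assume m: "m \<notin> {1..n ^ Suc k}"
    have "?t r = 0" if "r \<in> {1..n}" for r
    proof (rule z, rule notI)
      assume a: "(r - 1) * ?q < m \<and> m \<le> (r - 1) * ?q + ?q"
      have "(r - 1) * ?q + ?q = r * ?q" using that by (cases r) auto
      also have "\<dots> \<le> n * ?q" using that by simp
      finally show False using a m by auto
    qed
    then show "coeff (P_poly n (Suc k) j) m = 0"
      unfolding coeff_P_poly_Suc by (intro sum.neutral) blast
  qed
qed

lemma coeff_P_poly_stable:
  assumes n: "n > 0" and m: "m \<le> n ^ k"
  shows "coeff (P_poly n (Suc k) 1) m = coeff (P_poly n k 1) m"
proof -
  have "coeff (P_poly n (Suc k) 1) m = (\<Sum>r\<in>{1::nat}. if (r - 1) * n ^ k \<le> m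
     then root_unity n ^ ((1 - 1) * (r - 1)) * coeff (P_poly n k r) (m - (r - 1) * n ^ k) else 0)"
    unfolding coeff_P_poly_Suc
  proof (rule sum.mono_neutral_right)
    show "\<forall>i\<in>{1..n} - {1}. (if (i - 1) * n ^ k \<le> m
       then root_unity n ^ ((1 - 1) * (i - 1)) * coeff (P_poly n k i) (m - (i - 1) * n ^ k) else 0) = 0"
    proof
      fix i assume "i \<in> {1..n} - {1}"
      then have "1 * n ^ k \<le> (i - 1) * n ^ k" by (intro mult_right_mono) auto
      then have "m - (i - 1) * n ^ k = 0" using m by linarith
      then show "(if (i - 1) * n ^ k \<le> m
       then root_unity n ^ ((1 - 1) * (i - 1)) * coeff (P_poly n k i) (m - (i - 1) * n ^ k) else 0) = 0"
        using coeff_P_poly[OF n, of 0 k i] by simp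
    qed
  qed (use n in auto)
  then show ?thesis by simp
qed

lemma is_eps_seq_coeff:
  assumes "is_eps_seq n \<epsilon>" "m \<in> {1..n ^ k}"
  shows "\<epsilon> m = coeff (P_poly n k 1) m"
  using assms unfolding is_eps_seq_def by (simp add: coeff_sum)

lemma is_eps_seq_exists:
  assumes n: "n > 1"
  shows "\<exists>\<epsilon>. is_eps_seq n \<epsilon>"
proof -
  have n0: "n > 0" using n by simp
  define \<epsilon> where "\<epsilon> m = coeff (P_poly n m 1) m" for m
  have lt: "m \<le> n ^ m" for m
    using power_gt_expt[of n m] n by simp
  have up: "coeff (P_poly n (k + d) 1) m = coeff (P_poly n k 1) m" if "m \<le> n ^ k" for k d m
  proof (induction d)
    case (Suc d)
    have "n ^ k \<le> n ^ (k + d)" using n by (intro power_increasing) auto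
    then show ?case using Suc coeff_P_poly_stable[OF n0, of m "k + d"] that by simp
  qed simp
  have ag: "coeff (P_poly n k 1) m = \<epsilon> m" if "m \<le> n ^ k" for k m
    using up[OF that, of m] up[OF lt, of m k] unfolding \<epsilon>_def by (simp add: add.commute)
  have "is_eps_seq n \<epsilon>" unfolding is_eps_seq_def
  proof (intro conjI allI impI)
    fix m :: nat assume "1 \<le> m"
    then obtain a where "\<epsilon> m = root_unity n ^ a"
      using coeff_P_poly[OF n0, of m m 1] lt[of m] unfolding \<epsilon>_def by auto
    then show "\<epsilon> m \<in> {root_unity n ^ j | j. j \<le> n - 1}"
      using root_unity_power_mod[OF n0] by simp
  next
    fix k
    show "P_poly n k 1 = (\<Sum>m = 1..n ^ k. monom (\<epsilon> m) m)"
    proof (rule poly_eqI)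
      fix m
      show "coeff (P_poly n k 1) m = coeff (\<Sum>m = 1..n ^ k. monom (\<epsilon> m) m) m"
        using ag[of m k] coeff_P_poly[OF n0, of m k 1] by (simp add: coeff_sum)
    qed
  qed
  then show ?thesis by blast
qed

end

theory Submission
  imports Defs
begin

text \<open>
  On the unit circle the matrix of the recurrence is a discrete Fourier matrix times a diagonal
  matrix of unimodular entries, hence $\sqrt n$ times a unitary matrix. The vector
  $v_0 = (x,\dots,x)^t$ has Euclidean norm $\sqrt n$, so $v_k$ has norm exactly
  $n^{(k+1)/2}$, and every single $|P_k^{(j)}(x)|$ is at most $\sqrt n\,\sqrt{n^k}$
  (\<open>norm_P_poly_le\<close>). This is the root-$N$ bound for sums of length $N = n^k$.

  For a general length, the right-hand side of the recurrence puts $n$ polynomials of length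
  $n^k$ one after another, up to unimodular factors. A cut through $P_{k+1}^{(j)}$ therefore
  leaves each of these blocks complete or removes it, except for the one block that it hits.
  Complete blocks obey the bound above, and the block that is hit is a truncation at level $k$.
  If $T_k$ bounds all truncations at level $k$, this gives
  $T_{k+1} \le (n-1)\,n^{(k+1)/2} + T_k$. The increments grow geometrically, so $T_k$ is of the
  order of the last one; since $(\sqrt n-1)(n+\sqrt n) = (n-1)\sqrt n$, the choice
  $T_k = (n+\sqrt n)\,n^{k/2}$ is reproduced by the induction
  (\<open>norm_poly_cutoff_P_poly_le\<close>). A sum of length $N$ with $n^k \le N < n^{k+1}$ is a
  truncation of $P_{k+1}^{(1)}$, which costs a last factor $\sqrt n$.
\<close>

section \<open>The discrete Fourier matrix\<close>

lemma norm_root_unity: "norm (root_unity n) = 1"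
proof -
  have "root_unity n = cis (2 * pi / of_nat n)"
    unfolding root_unity_def cis_conv_exp by (simp add: mult_ac)
  then show ?thesis by simp
qed

lemma root_unity_power_inj:
  assumes "n > 0" "a < n" "b < n" "root_unity n ^ a = root_unity n ^ b"
  shows "a = b"
proof -
  have "root_unity n ^ c = exp (2 * of_real pi * \<i> * of_nat c / of_nat n)" for c
    unfolding root_unity_def exp_of_nat_mult[symmetric] by (simp add: mult_ac)
  then have "a mod n = b mod n"
    using assms complex_root_unity_eq[of n a b] by (simp add: cong_def)
  then show ?thesis using assms by simp
qed

lemma root_unity_orthogonal:
  assumes n: "n > 0" and ab: "a < n" "b < n"
  shows "(\<Sum>j<n. root_unity n ^ (j * a) * cnj (root_unity n ^ (j * b))) =
    (if a = b then of_nat n else 0)"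
proof -
  let ?w = "root_unity n"
  define z where "z = ?w ^ a * cnj (?w ^ b)"
  have unit: "?w ^ c * cnj (?w ^ c) = 1" for c
    by (simp add: complex_norm_square[symmetric] norm_power norm_root_unity del: complex_cnj_power)
  have sum: "(\<Sum>j<n. ?w ^ (j * a) * cnj (?w ^ (j * b))) = (\<Sum>j<n. z ^ j)"
    unfolding z_def by (simp add: power_mult_distrib power_mult[symmetric] mult.commute)
  show ?thesis
  proof (cases "a = b")
    case True
    then have "z = 1" unfolding z_def using unit by simp
    then show ?thesis using True sum by simp
  next
    case False
    have "z \<noteq> 1"
    proof
      assume "z = 1"
      then have "?w ^ b = ?w ^ a * cnj (?w ^ b) * ?w ^ b" unfolding z_def by simp
      also have "\<dots> = ?w ^ a" using unit[of b] by (simp add: mult_ac)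
      finally show False using root_unity_power_inj[OF n ab] False by simp
    qed
    have "z ^ n = (?w ^ n) ^ a * cnj ((?w ^ n) ^ b)"
      unfolding z_def by (simp add: power_mult_distrib power_mult[symmetric] mult.commute)
    then have "z ^ n = 1" using root_unity_power_n[OF n] by simp
    then show ?thesis using \<open>z \<noteq> 1\<close> False sum by (simp add: geometric_sum)
  qed
qed

text \<open>Parseval's identity; it makes the matrix of the recurrence $\sqrt n$ times an isometry.\<close>

lemma parseval_root_unity:
  fixes a :: "nat \<Rightarrow> complex"
  assumes n: "n > 0"
  shows "(\<Sum>j<n. (norm (\<Sum>r<n. root_unity n ^ (j * r) * a r))\<^sup>2) = real n * (\<Sum>r<n. (norm (a r))\<^sup>2)"
proof -
  let ?w = "root_unity n"
  have "complex_of_real (\<Sum>j<n. (norm (\<Sum>r<n. ?w ^ (j * r) * a r))\<^sup>2) =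
      (\<Sum>j<n. \<Sum>r<n. \<Sum>s<n. ?w ^ (j * r) * a r * cnj (?w ^ (j * s) * a s))"
    by (simp only: of_real_sum complex_norm_square cnj_sum sum_product)
  also have "\<dots> = (\<Sum>r<n. \<Sum>s<n. \<Sum>j<n. ?w ^ (j * r) * a r * cnj (?w ^ (j * s) * a s))"
    by (subst sum.swap, rule sum.cong[OF refl], rule sum.swap)
  also have "\<dots> = (\<Sum>r<n. \<Sum>s<n. a r * cnj (a s) *
      (\<Sum>j<n. ?w ^ (j * r) * cnj (?w ^ (j * s))))"
    by (simp only: sum_distrib_left complex_cnj_mult mult_ac)
  also have "\<dots> = (\<Sum>r<n. \<Sum>s<n. if r = s then a r * cnj (a s) * of_nat n else 0)"
    by (intro sum.cong refl) (simp add: root_unity_orthogonal[OF n] del: complex_cnj_power)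
  also have "\<dots> = complex_of_real (real n * (\<Sum>r<n. (norm (a r))\<^sup>2))"
    by (simp only: sum.delta finite_lessThan of_real_mult of_real_sum of_real_of_nat_eq
        complex_norm_square sum_distrib_left mult_ac lessThan_iff) simp
  finally show ?thesis using of_real_eq_iff by blast
qed

section \<open>Complete polynomials on the unit circle\<close>

lemma sum_norm_P_poly_squared:
  assumes n: "n > 0" and x: "norm x = 1"
  shows "(\<Sum>j<n. (norm (poly (P_poly n k (Suc j)) x))\<^sup>2) = real n ^ Suc k"
proof (induction k)
  case 0
  then show ?case using x by (simp add: poly_monom)
next
  case (Suc k)
  have "poly (P_poly n (Suc k) (Suc j)) x =
      (\<Sum>r<n. root_unity n ^ (j * r) * (x ^ (r * n ^ k) * poly (P_poly n k (Suc r)) x))" for j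
    by (simp add: poly_sum poly_monom mult_ac sum.atLeast1_atMost_eq)
  then have "(\<Sum>j<n. (norm (poly (P_poly n (Suc k) (Suc j)) x))\<^sup>2) =
      real n * (\<Sum>r<n. (norm (x ^ (r * n ^ k) * poly (P_poly n k (Suc r)) x))\<^sup>2)"
    by (simp only: parseval_root_unity[OF n])
  then show ?case using Suc.IH x by (simp add: norm_mult norm_power)
qed

lemma norm_P_poly_le:
  assumes n: "n > 0" and x: "norm x = 1" and j: "j \<in> {1..n}"
  shows "norm (poly (P_poly n k j) x) \<le> sqrt (real n ^ Suc k)"
proof (rule real_le_rsqrt)
  have "(norm (poly (P_poly n k (Suc (j - 1))) x))\<^sup>2 \<le> real n ^ Suc k"
    unfolding sum_norm_P_poly_squared[OF n x, symmetric]
    by (rule member_le_sum) (use j in auto)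
  then show "(norm (poly (P_poly n k j) x))\<^sup>2 \<le> real n ^ Suc k" using j by simp
qed

section \<open>Truncated polynomials\<close>

lemma poly_poly_cutoff:
  fixes x :: "'a::comm_semiring_1"
  shows "poly (poly_cutoff N p) x = (\<Sum>m<N. coeff p m * x ^ m)"
proof -
  have "poly_cutoff N p = (\<Sum>m<N. monom (coeff p m) m)"
    by (rule poly_eqI) (simp add: coeff_poly_cutoff coeff_sum)
  then show ?thesis by (simp add: poly_sum poly_monom)
qed

lemma poly_cutoff_monom_mult:
  "poly_cutoff N (monom c d * p) = monom c d * poly_cutoff (N - d) p"
  by (rule poly_eqI) (auto simp: coeff_poly_cutoff coeff_monom_mult)

lemma poly_cutoff_sum: "poly_cutoff N (sum f A) = (\<Sum>i\<in>A. poly_cutoff N (f i))"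
  by (rule poly_eqI) (simp add: coeff_poly_cutoff coeff_sum)

lemma poly_cutoff_P_poly_full:
  assumes "n > 0" "N > n ^ k"
  shows "poly_cutoff N (P_poly n k j) = P_poly n k j"
  by (rule poly_eqI) (use assms coeff_P_poly[of n _ k j] in \<open>auto simp: coeff_poly_cutoff\<close>)

text \<open>Multiplying the $r$-th block by $x^{(r-1)n^k}$ turns a cut of the whole polynomial into a
  cut of the block. The truncated subtraction is harmless: a cut before the start of the block
  keeps no term of it.\<close>

lemma norm_poly_cutoff_P_poly_Suc_le:
  assumes x: "norm x = 1"
  shows "norm (poly (poly_cutoff N (P_poly n (Suc k) j)) x) \<le>
    (\<Sum>r=1..n. norm (poly (poly_cutoff (N - (r - 1) * n ^ k) (P_poly n k r)) x))"
proof -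
  have "norm (poly (poly_cutoff N (P_poly n (Suc k) j)) x) =
      norm (\<Sum>r=1..n. root_unity n ^ ((j - 1) * (r - 1)) * x ^ ((r - 1) * n ^ k) *
        poly (poly_cutoff (N - (r - 1) * n ^ k) (P_poly n k r)) x)"
    by (simp add: poly_cutoff_sum poly_cutoff_monom_mult poly_sum poly_monom)
  also have "\<dots> \<le> (\<Sum>r=1..n. norm (root_unity n ^ ((j - 1) * (r - 1)) * x ^ ((r - 1) * n ^ k) *
        poly (poly_cutoff (N - (r - 1) * n ^ k) (P_poly n k r)) x))"
    by (rule norm_sum)
  also have "\<dots> = (\<Sum>r=1..n. norm (poly (poly_cutoff (N - (r - 1) * n ^ k) (P_poly n k r)) x))"
    by (simp only: norm_mult norm_power norm_root_unity x power_one mult_1)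
  finally show ?thesis .
qed

text \<open>Only the block with $(r-1)q < N \le rq$ can be cut properly. The second alternative is
  strict because \<open>poly_cutoff\<close> keeps the degrees below its bound, while a block of length
  $q$ has degrees $1,\dots,q$.\<close>

lemma cut_block_cases:
  fixes N q r :: nat
  assumes q: "q > 0" and r: "r \<ge> 1" "r \<noteq> Suc ((N - 1) div q)"
  shows "N - (r - 1) * q = 0 \<or> N - (r - 1) * q > q"
proof -
  define s where "s = (N - 1) div q"
  have s1: "s * q \<le> N - 1" and s2: "N \<le> (s + 1) * q"
    using dividend_less_div_times[OF q, of "N - 1"] unfolding s_def by auto
  from r(2) consider "r - 1 > s" | "r \<le> s" "r - 1 < s" using r(1) s_def by linarith
  then show ?thesis
  proof cases
    case 1
    then have "(s + 1) * q \<le> (r - 1) * q" by (intro mult_right_mono) auto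
    then show ?thesis using s2 by simp
  next
    case 2
    then have "(r - 1 + 1) * q \<le> s * q" using r by (intro mult_right_mono) auto
    then have "(r - 1) * q + q \<le> s * q" by (simp only: distrib_right mult_1)
    moreover have "s * q > 0" using 2 q by simp
    ultimately have "(r - 1) * q + q < N" using s1 by linarith
    then show ?thesis by simp
  qed
qed

lemma norm_poly_cutoff_P_poly_le:
  assumes n: "n > 1" and x: "norm x = 1" and j: "j \<in> {1..n}"
  shows "norm (poly (poly_cutoff N (P_poly n k j)) x) \<le> (real n + sqrt (real n)) * sqrt (real n ^ k)"
  using j
proof (induction k arbitrary: j N)
  case 0
  have "norm (poly (poly_cutoff N (P_poly n 0 j)) x) \<le> 1"
  proof (cases "N > 1")
    case True
    then show ?thesis using n x poly_cutoff_P_poly_full[of n 0 N j] by (simp add: poly_monom)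
  next
    case False
    then have "poly_cutoff N (P_poly n 0 j) = 0"
      by (intro poly_eqI) (auto simp: coeff_poly_cutoff)
    then show ?thesis by simp
  qed
  also have "1 \<le> real n + sqrt (real n)"
    using n real_sqrt_ge_zero[of "real n"] by linarith
  finally show ?case by simp
next
  case (Suc k)
  let ?q = "n ^ k" and ?s = "sqrt (real n)" and ?t = "sqrt (real n ^ k)"
  let ?f = "\<lambda>r. norm (poly (poly_cutoff (N - (r - 1) * ?q) (P_poly n k r)) x)"
  have n0: "n > 0" and q: "?q > 0" and ss: "?s * ?s = real n" using n by simp_all
  \<comment> \<open>The block that is hit; for a cut beyond the end of the polynomial, any block will do.\<close>
  define r0 where "r0 = min n (Suc ((N - 1) div ?q))"
  have r0: "r0 \<in> {1..n}" unfolding r0_def using n by auto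
  have complete: "?f r \<le> ?s * ?t" if "r \<in> {1..n} - {r0}" for r
  proof -
    have "r \<ge> 1" "r \<noteq> Suc ((N - 1) div ?q)" using that unfolding r0_def by auto
    from cut_block_cases[OF q this] show ?thesis
    proof
      assume "N - (r - 1) * ?q = 0"
      then show ?thesis by (simp add: poly_poly_cutoff)
    next
      assume "N - (r - 1) * ?q > ?q"
      then have "?f r = norm (poly (P_poly n k r) x)"
        by (simp only: poly_cutoff_P_poly_full[OF n0])
      also have "\<dots> \<le> sqrt (real n ^ Suc k)"
        using norm_P_poly_le[OF n0 x] that by blast
      finally show ?thesis by (simp add: real_sqrt_mult)
    qed
  qed
  have "norm (poly (poly_cutoff N (P_poly n (Suc k) j)) x) \<le> (\<Sum>r=1..n. ?f r)"
    by (rule norm_poly_cutoff_P_poly_Suc_le[OF x])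
  also have "\<dots> = ?f r0 + (\<Sum>r\<in>{1..n} - {r0}. ?f r)"
    using r0 by (simp add: sum.remove)
  also have "\<dots> \<le> (real n + ?s) * ?t + of_nat (card ({1..n} - {r0})) * (?s * ?t)"
    by (intro add_mono Suc.IH[OF r0] sum_bounded_above complete)
  also have "card ({1..n} - {r0}) = n - 1" using r0 by simp
  also have "(real n + ?s) * ?t + of_nat (n - 1) * (?s * ?t) = (?s * ?s + real n * ?s) * ?t"
    using n by (simp add: of_nat_diff algebra_simps)
  also have "\<dots> = (real n + ?s) * sqrt (real n ^ Suc k)"
    by (simp add: real_sqrt_mult algebra_simps)
  finally show ?case .
qed

section \<open>The root-$N$ property\<close>

lemma poly_cutoff_P_poly_eps_seq:
  assumes n: "n > 0" and eps: "is_eps_seq n \<epsilon>" and N: "N \<le> n ^ k"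
  shows "poly (poly_cutoff (Suc N) (P_poly n k 1)) x = (\<Sum>m=1..N. \<epsilon> m * x ^ m)"
proof -
  have zero: "coeff (P_poly n k 1) 0 = 0" using coeff_P_poly[OF n, of 0 k 1] by simp
  have "poly (poly_cutoff (Suc N) (P_poly n k 1)) x = (\<Sum>m\<in>{1..N}. coeff (P_poly n k 1) m * x ^ m)"
    unfolding poly_poly_cutoff
  proof (rule sum.mono_neutral_right)
    show "\<forall>m\<in>{..<Suc N} - {1..N}. coeff (P_poly n k 1) m * x ^ m = 0"
    proof
      fix m assume "m \<in> {..<Suc N} - {1..N}"
      then have "m = 0" by auto
      then show "coeff (P_poly n k 1) m * x ^ m = 0" using zero by (simp only: mult_zero_left)
    qed
  qed auto
  also have "\<dots> = (\<Sum>m=1..N. \<epsilon> m * x ^ m)"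
  proof (rule sum.cong[OF refl])
    fix m assume "m \<in> {1..N}"
    then have "m \<in> {1..n ^ k}" using N by simp
    then show "coeff (P_poly n k 1) m * x ^ m = \<epsilon> m * x ^ m"
      by (simp only: is_eps_seq_coeff[OF eps])
  qed
  finally show ?thesis .
qed

theorem theorem4p1:
  fixes n :: nat and \<epsilon> :: "nat \<Rightarrow> complex"
  assumes "n > 2"
    and "is_eps_seq n \<epsilon>"
  shows "root_N_property \<epsilon>"
proof -
  let ?D = "real n + sqrt (real n)"
  have D: "?D > 0" using assms(1) by (simp add: add_pos_pos)
  have "(SUP x\<in>{x::complex. norm x = 1}. norm (\<Sum>m = 1..N. \<epsilon> m * x ^ m))
      \<le> (?D * sqrt (real n)) * sqrt (real N)" if N: "N \<ge> 1" for N :: nat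
  proof (rule cSUP_least)
    show "{x::complex. norm x = 1} \<noteq> {}" using norm_one by blast
    fix x :: complex assume "x \<in> {x. norm x = 1}"
    then have x: "norm x = 1" by simp
    obtain k where k: "n ^ k \<le> N" "N < n ^ Suc k"
      using ex_power_ivl1[of n N] assms(1) N by auto
    have "norm (\<Sum>m = 1..N. \<epsilon> m * x ^ m) \<le> ?D * sqrt (real n ^ Suc k)"
      using norm_poly_cutoff_P_poly_le[of n x 1 "Suc N" "Suc k"] assms(1) x k(2)
        poly_cutoff_P_poly_eps_seq[OF _ assms(2), of N "Suc k" x] by simp
    also have "\<dots> = ?D * sqrt (real n) * sqrt (real (n ^ k))"
      by (simp add: real_sqrt_mult)
    also have "\<dots> \<le> ?D * sqrt (real n) * sqrt (real N)"
      using D k(1) by (intro mult_left_mono real_sqrt_le_mono) auto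
    finally show "norm (\<Sum>m = 1..N. \<epsilon> m * x ^ m) \<le> (?D * sqrt (real n)) * sqrt (real N)" .
  qed
  moreover have "?D * sqrt (real n) > 0" using D assms(1) by simp
  ultimately show ?thesis unfolding root_N_property_def by blast
qed

end
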